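(* Let $\Omega$ be an infinite set, let $\mathrm{Sym}(\Omega)$ be the group of all permutations of $\Omega$, and let $U\subseteq\mathrm{Sym}(\Omega)$ be a subset that generates $\mathrm{Sym}(\Omega)$ as a group (respectively, as a monoid). Then there exists a positive integer $n$ such that every element of $\mathrm{Sym}(\Omega)$ is represented by a group word (respectively, a monoid word) of length $\leq n$ in the elements of $U$.
   Context: A monoid word of length $\leq n$ in the elements of $U$ is a product of at most $n$ factors, each belonging to $U$; a group word of length $\leq n$ in the elements of $U$ is a product of at most $n$ factors, each belonging to $U\cup U^{-1}$, where $U^{-1}=\{u^{-1}:u\in U\}$. The empty product is the identity. The theorem makes two assertions: one for generation as a group (with group words) and one for generation as a monoid (with monoid words). *)

theory Defs
  imports "HOL-Algebra.Bij" "HOL-Algebra.Generated_Groups"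
begin

inductive_set generate_monoid :: "('a, 'b) monoid_scheme \<Rightarrow> 'a set \<Rightarrow> 'a set"
  for G and U where
    one:  "\<one>\<^bsub>G\<^esub> \<in> generate_monoid G U"
  | incl: "u \<in> U \<Longrightarrow> u \<in> generate_monoid G U"
  | eng:  "x \<in> generate_monoid G U \<Longrightarrow> y \<in> generate_monoid G U
            \<Longrightarrow> x \<otimes>\<^bsub>G\<^esub> y \<in> generate_monoid G U"

lemma (in monoid) generate_monoid_eq_Inter_submonoids:
  assumes "U \<subseteq> carrier G"
  shows "generate_monoid G U = \<Inter>{M. submonoid M G \<and> U \<subseteq> M}"
proof
  show "generate_monoid G U \<subseteq> \<Inter>{M. submonoid M G \<and> U \<subseteq> M}"
  proof
    fix x assume "x \<in> generate_monoid G U"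
    then show "x \<in> \<Inter>{M. submonoid M G \<and> U \<subseteq> M}"
      by induction (auto intro: submonoid.one_closed submonoid.m_closed)
  qed
  have "x \<in> carrier G" if "x \<in> generate_monoid G U" for x
    using that assms by induction auto
  then have "submonoid (generate_monoid G U) G"
    by unfold_locales (auto intro: generate_monoid.intros)
  then show "\<Inter>{M. submonoid M G \<and> U \<subseteq> M} \<subseteq> generate_monoid G U"
    by (auto intro: generate_monoid.incl)
qed

definition word_value :: "('a, 'b) monoid_scheme \<Rightarrow> 'a list \<Rightarrow> 'a"
  where "word_value G ws = foldr (\<lambda>x y. x \<otimes>\<^bsub>G\<^esub> y) ws \<one>\<^bsub>G\<^esub>"

text \<open>The elements of \<open>G\<close> that are represented by words of length at most \<open>n\<close>.\<close>

definition monoid_words :: "('a, 'b) monoid_scheme \<Rightarrow> 'a set \<Rightarrow> nat \<Rightarrow> 'a set"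
  where "monoid_words G U n = {word_value G ws | ws. set ws \<subseteq> U \<and> length ws \<le> n}"

definition group_words :: "('a, 'b) monoid_scheme \<Rightarrow> 'a set \<Rightarrow> nat \<Rightarrow> 'a set"
  where "group_words G U n =
    {word_value G ws | ws. set ws \<subseteq> U \<union> {inv\<^bsub>G\<^esub> u | u. u \<in> U} \<and> length ws \<le> n}"

end

theory Submission
  imports Defs "HOL-Combinatorics.Permutations" "HOL-Library.Equipollence"
begin

text \<open>
  Let \<open>W n\<close> be the set of permutations of \<open>\<Omega>\<close> that are monoid words of length at most \<open>n\<close> over an
  alphabet \<open>V\<close>; the two assertions of the theorem are the cases \<open>V = U \<union> U\<inverse>\<close> and \<open>V = U\<close>. The
  sets \<open>W n\<close> increase, satisfy \<open>W m \<circ> W n \<subseteq> W (m + n)\<close>, and together contain every permutation.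
  From these three properties (locale \<open>permutation_filtration\<close>) it follows that one \<open>W n\<close> contains
  every permutation.

  The first half of the argument is that sequences of permutations can be coded by finitely many
  permutations. Since \<open>\<Omega>\<close> is infinite, it is in bijection with \<open>\<Omega> \<times> \<int> \<times> \<int>\<close>, a plane grid of copies
  of itself. For a sequence \<open>h\<close> of permutations of \<open>\<Omega>\<close>, let \<open>P\<close> act by \<open>h i\<close> on every copy \<open>(i, j)\<close>
  with \<open>i, j \<ge> 0\<close>. Conjugating \<open>P\<close> by the \<open>n\<close>-th power of the shift in the first coordinate puts
  \<open>h n\<close> on the copies \<open>(0, j)\<close> with \<open>j \<ge> 0\<close>. The commutator of the result with the shift along the
  line \<open>i = 0\<close> cancels everything except \<open>h n\<close> on the single copy \<open>(0, 0)\<close>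
  (\<open>isolate_term\<close>). So this permutation is a word of length \<open>O(n)\<close> in finitely many permutations,
  which all lie in one \<open>W k\<close>. If no \<open>W n\<close> contained all permutations supported on the copy
  \<open>(0, 0)\<close>, one could choose \<open>h n\<close> such that this permutation lies outside the \<open>W\<close>
  whose index is \<open>n\<close> times that length, and the term with \<open>n = k\<close> would be a contradiction (\<open>copy0_level\<close>).

  Hence some \<open>W n\<close> contains all permutations supported on a set \<open>M\<close> such that \<open>M\<close> and \<open>\<Omega> - M\<close> have
  the cardinality of \<open>\<Omega>\<close>. The second half is that every permutation is a bounded product
  of permutations supported on \<open>M\<close> and of one fixed involution. Split \<open>M\<close> into
  \<open>A\<close> and \<open>B\<close> of full cardinality and put \<open>C = \<Omega> - M\<close>. Up to composition with an involution \<open>s\<close>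
  that exchanges \<open>A\<close> and \<open>C\<close>, every permutation is a product of three permutations supported on
  \<open>B \<union> C\<close>, \<open>A \<union> B\<close> and \<open>B \<union> C\<close> (\<open>factor_permutation\<close>), and conjugation by \<open>s\<close> carries the
  permutations supported on \<open>B \<union> C\<close> to those supported on \<open>A \<union> B = M\<close>.
\<close>

section \<open>Filtrations of a symmetric group\<close>

text \<open>
  A permutation of \<open>\<Omega>\<close> is taken as a function on the whole type that fixes the points outside \<open>\<Omega>\<close>,
  so that a permutation of a subset of \<open>\<Omega>\<close> is literally a permutation of \<open>\<Omega>\<close>.
\<close>

locale permutation_filtration =
  fixes \<Omega> :: "'a set" and W :: "nat \<Rightarrow> ('a \<Rightarrow> 'a) set"
  assumes mono: "m \<le> n \<Longrightarrow> W m \<subseteq> W n"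
    and comp: "f \<in> W m \<Longrightarrow> g \<in> W n \<Longrightarrow> f \<circ> g \<in> W (m + n)"
    and exhaustive: "p permutes \<Omega> \<Longrightarrow> \<exists>n. p \<in> W n"
begin

lemma finite_subset_level:
  assumes "finite F" and "\<And>p. p \<in> F \<Longrightarrow> p permutes \<Omega>"
  shows "\<exists>n. F \<subseteq> W n"
  using assms
proof (induction F)
  case (insert p F)
  then obtain m n where "p \<in> W m" "F \<subseteq> W n"
    using exhaustive by blast
  then have "insert p F \<subseteq> W (max m n)"
    using mono[of m "max m n"] mono[of n "max m n"] by auto
  then show ?case ..
qed auto

text \<open>This lets the grid \<open>\<Omega> \<times> \<int> \<times> \<int>\<close> replace \<open>\<Omega>\<close>.\<close>

lemma transport:
  assumes \<phi>: "bij_betw \<phi> D \<Omega>"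
  shows "permutation_filtration D (\<lambda>n. {p. p permutes D \<and> map_permutation D \<phi> p \<in> W n})"
proof
  fix f g m n
  assume "f \<in> {p. p permutes D \<and> map_permutation D \<phi> p \<in> W m}"
    and "g \<in> {p. p permutes D \<and> map_permutation D \<phi> p \<in> W n}"
  then show "f \<circ> g \<in> {p. p permutes D \<and> map_permutation D \<phi> p \<in> W (m + n)}"
    using \<phi> by (auto simp: map_permutation_compose' bij_betw_def permutes_compose comp)
next
  fix p assume "p permutes D"
  then show "\<exists>n. p \<in> {p. p permutes D \<and> map_permutation D \<phi> p \<in> W n}"
    using exhaustive map_permutation_permutes[OF \<phi>] by blast
qed (use mono in blast)

end

section \<open>Isolating one term of a sequence of permutations\<close>

text \<open>
  In \<open>X \<times> \<int> \<times> \<int>\<close>, the copy \<open>(i, j)\<close> is \<open>X \<times> {(i, j)}\<close> and the line \<open>i\<close> consists of the copies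
  \<open>(i, j)\<close> for all \<open>j\<close>.
\<close>

definition shift_lines :: "'a set \<Rightarrow> int \<Rightarrow> 'a \<times> int \<times> int \<Rightarrow> 'a \<times> int \<times> int"
  where "shift_lines X k = (\<lambda>(x, i, j). if x \<in> X then (x, i + k, j) else (x, i, j))"

definition shift_along_line0 :: "'a set \<Rightarrow> int \<Rightarrow> 'a \<times> int \<times> int \<Rightarrow> 'a \<times> int \<times> int"
  where "shift_along_line0 X k =
    (\<lambda>(x, i, j). if x \<in> X \<and> i = 0 then (x, i, j + k) else (x, i, j))"

text \<open>
  A line carries the same permutation on a half-line of copies, so that shifting the line by one
  step changes the permutation on exactly one copy.
\<close>

definition spread :: "(nat \<Rightarrow> 'a \<Rightarrow> 'a) \<Rightarrow> 'a \<times> int \<times> int \<Rightarrow> 'a \<times> int \<times> int"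
  where "spread h = (\<lambda>(x, i, j). if 0 \<le> i \<and> 0 \<le> j then (h (nat i) x, i, j) else (x, i, j))"

abbreviation on_copy0 :: "'a set \<Rightarrow> ('a \<Rightarrow> 'a) \<Rightarrow> 'a \<times> int \<times> int \<Rightarrow> 'a \<times> int \<times> int"
  where "on_copy0 X g \<equiv> map_permutation X (\<lambda>x. (x, 0, 0)) g"

lemma on_copy0_apply:
  assumes "g permutes X"
  shows "on_copy0 X g (x, i, j) = (if i = 0 \<and> j = 0 then (g x, i, j) else (x, i, j))"
proof (cases "x \<in> X \<and> i = 0 \<and> j = 0")
  case True
  then show ?thesis
    using map_permutation_apply[of "\<lambda>x. (x, 0::int, 0::int)" X x g] by (simp add: inj_on_def)
next
  case False
  then have "(x, i, j) \<notin> (\<lambda>x. (x, 0, 0)) ` X" by auto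
  then have "on_copy0 X g (x, i, j) = (x, i, j)"
    by (simp add: map_permutation_def)
  then show ?thesis
    using False permutes_not_in[OF assms] by auto
qed

lemma shift_lines_permutes: "shift_lines X k permutes X \<times> UNIV"
proof (rule bij_imp_permutes)
  show "bij_betw (shift_lines X k) (X \<times> UNIV) (X \<times> UNIV)"
    by (rule bij_betw_byWitness[where f' = "shift_lines X (- k)"]) (auto simp: shift_lines_def)
qed (auto simp: shift_lines_def split: if_splits)

lemma shift_along_line0_permutes: "shift_along_line0 X k permutes X \<times> UNIV"
proof (rule bij_imp_permutes)
  show "bij_betw (shift_along_line0 X k) (X \<times> UNIV) (X \<times> UNIV)"
    by (rule bij_betw_byWitness[where f' = "shift_along_line0 X (- k)"])
      (auto simp: shift_along_line0_def split: if_splits)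
qed (auto simp: shift_along_line0_def split: if_splits)

lemma spread_permutes:
  assumes "\<And>n. h n permutes X"
  shows "spread h permutes X \<times> UNIV"
proof (rule bij_imp_permutes)
  show "bij_betw (spread h) (X \<times> UNIV) (X \<times> UNIV)"
    by (rule bij_betw_byWitness[where f' = "spread (\<lambda>n. inv_into UNIV (h n))"])
      (auto simp: spread_def permutes_inverses[OF assms] permutes_in_image[OF assms]
        permutes_in_image[OF permutes_inv[OF assms]] split: if_splits)
  show "spread h z = z" if "z \<notin> X \<times> UNIV" for z
    using that permutes_not_in[OF assms] by (cases z) (simp add: spread_def)
qed

text \<open>
  With \<open>P\<close> for \<open>spread h\<close> conjugated by \<open>shift_lines X n\<close> and \<open>S\<close> for the shift along line 0, the left
  side is \<open>P S P\<inverse> S\<inverse>\<close>. Off the line 0 the factors \<open>S\<close> are trivial and \<open>P P\<inverse>\<close> cancels. On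
  the line 0, \<open>P\<close> is \<open>h n\<close> for \<open>j \<ge> 0\<close>, while \<open>S P\<inverse> S\<inverse>\<close> is its inverse for \<open>j \<ge> 1\<close>
  only.
\<close>

lemma isolate_term:
  assumes h: "\<And>n. h n permutes X"
  shows "shift_lines X (- int n) \<circ> spread h \<circ> shift_lines X (int n) \<circ> shift_along_line0 X 1 \<circ>
      (shift_lines X (- int n) \<circ> spread (\<lambda>n. inv_into UNIV (h n)) \<circ> shift_lines X (int n) \<circ>
        shift_along_line0 X (- 1)) = on_copy0 X (h n)"
    (is "?lhs = _")
proof -
  have "?lhs (x, i, j) = on_copy0 X (h n) (x, i, j)" for x i j
    by (cases "x \<in> X")
      (auto simp: on_copy0_apply[OF h] shift_lines_def shift_along_line0_def spread_def
        permutes_inverses[OF h] permutes_in_image[OF h] permutes_in_image[OF permutes_inv[OF h]]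
        permutes_not_in[OF h] permutes_not_in[OF permutes_inv[OF h]])
  then show ?thesis
    by (simp add: fun_eq_iff)
qed

lemma shift_lines_power_level:
  assumes filt: "permutation_filtration D W" and "{id, shift_lines X e} \<subseteq> W k"
  shows "shift_lines X (int n * e) \<in> W (Suc n * k)"
proof (induction n)
  case 0
  have "shift_lines X (int 0 * e) = id" by (auto simp: shift_lines_def)
  then show ?case using assms(2) by (simp only: insert_subset mult_Suc mult_0 add_0_right)
next
  case (Suc n)
  have "shift_lines X (int (Suc n) * e) = shift_lines X e \<circ> shift_lines X (int n * e)"
    by (auto simp: shift_lines_def fun_eq_iff algebra_simps)
  then show ?case
    using permutation_filtration.comp[OF filt, of "shift_lines X e" k, OF _ Suc] assms(2)
    by (simp only: insert_subset mult_Suc)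
qed

text \<open>
  A diagonal argument: a sequence whose terms escape fast enough from the filtration would be coded
  by finitely many permutations of a common level \<open>k\<close>, and its \<open>k\<close>-th term would not escape.
\<close>

lemma copy0_level:
  fixes X :: "'a set"
  assumes "permutation_filtration (X \<times> UNIV) W"
  shows "\<exists>n. \<forall>g. g permutes X \<longrightarrow> on_copy0 X g \<in> W n"
proof (rule ccontr)
  interpret permutation_filtration "X \<times> (UNIV :: (int \<times> int) set)" W by fact
  \<comment> \<open>the length of the word in \<open>isolate_term\<close>: four powers of the shift of lines, each
    written with \<open>Suc n\<close> letters because the zeroth power takes the letter \<open>id\<close>, and four more factors\<close>
  define len where "len n = 4 * Suc n + 4" for n :: nat
  assume "\<not> ?thesis"
  then have "\<forall>n. \<exists>g. g permutes X \<and> on_copy0 X g \<notin> W (len n * n)"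
    by blast
  then obtain h where h: "\<And>n. h n permutes X"
    and escapes: "\<And>n. on_copy0 X (h n) \<notin> W (len n * n)"
    by metis
  have h': "inv_into UNIV (h n) permutes X" for n
    using h by (rule permutes_inv)
  let ?F = "{id, shift_lines X 1, shift_lines X (- 1), shift_along_line0 X 1,
    shift_along_line0 X (- 1), spread h, spread (\<lambda>n. inv_into UNIV (h n))}"
  have "p permutes X \<times> UNIV" if "p \<in> ?F" for p
    using that shift_lines_permutes shift_along_line0_permutes
      spread_permutes[of h, OF h] spread_permutes[of "\<lambda>n. inv_into UNIV (h n)", OF h']
    by (auto simp: permutes_id)
  then obtain k where k: "?F \<subseteq> W k"
    using finite_subset_level[of ?F] by blast
  have fwd: "shift_lines X (int k) \<in> W (Suc k * k)"
    using shift_lines_power_level[OF assms, of X 1 k k] k by simp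
  have bwd: "shift_lines X (- int k) \<in> W (Suc k * k)"
    using shift_lines_power_level[OF assms, of X "- 1" k k] k by simp
  have "on_copy0 X (h k) \<in> W ((Suc k * k + k + Suc k * k + k) + (Suc k * k + k + Suc k * k + k))"
    unfolding isolate_term[of h, OF h, symmetric]
    by (intro comp fwd bwd) (use k in auto)
  also have "(Suc k * k + k + Suc k * k + k) + (Suc k * k + k + Suc k * k + k) = len k * k"
    by (simp add: len_def algebra_simps)
  finally show False
    using escapes by blast
qed

section \<open>Factoring a permutation into permutations of smaller support\<close>

text \<open>
  Call a subset of an infinite set \<open>S\<close> large if it is equipollent to \<open>S\<close>. The small subsets form
  an ideal, because the union of two sets of cardinality less than an infinite cardinal is again
  of smaller cardinality.
\<close>

lemma eqpoll_Un_cases: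
  assumes "infinite S" and "A \<union> B \<approx> S"
  shows "A \<approx> S \<or> B \<approx> S"
proof (rule ccontr)
  assume neg: "\<not> ?thesis"
  have "A \<lesssim> S" "B \<lesssim> S"
    using assms(2) by (meson Un_upper1 Un_upper2 lepoll_trans1 lepoll_trans2 subset_imp_lepoll)+
  then have "\<not> S \<lesssim> A" "\<not> S \<lesssim> B"
    using neg lepoll_antisym by blast+
  then have "ordLess2 (card_of A) (card_of S)" "ordLess2 (card_of B) (card_of S)"
    unfolding lepoll_def by (metis card_of_ordLess)+
  then have "ordLess2 (card_of (A \<union> B)) (card_of S)"
    by (rule card_of_Un_ordLess_infinite[OF assms(1)])
  then show False
    using assms(2) eqpoll_iff_card_of_ordIso not_ordLess_ordIso by blast
qed

lemma eqpoll_between: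
  assumes "A \<subseteq> B" and "B \<subseteq> S" and "A \<approx> S"
  shows "B \<approx> S"
proof (rule lepoll_antisym)
  show "B \<lesssim> S"
    using assms(2) by (rule subset_imp_lepoll)
  show "S \<lesssim> B"
    using assms(1,3) by (metis eqpoll_sym lepoll_trans1 subset_imp_lepoll)
qed

lemma eqpoll_times_countable:
  assumes "infinite S" and "countable C" and "C \<noteq> {}"
  shows "S \<times> C \<approx> S"
proof -
  have "C \<lesssim> S"
    using assms(1,2) by (meson countable_def infinite_le_lepoll lepoll_def lepoll_trans subset_UNIV)
  then have "ordLeq3 (card_of C) (card_of S)"
    unfolding lepoll_def by (metis card_of_ordLeq)
  then show ?thesis
    using card_of_Times_infinite[OF assms(1,3)] by (simp add: eqpoll_iff_card_of_ordIso)
qed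

lemma split_infinite:
  assumes "infinite S"
  obtains A B where "A \<union> B = S" "A \<inter> B = {}" "A \<approx> S" "B \<approx> S"
proof -
  obtain f where f: "bij_betw f (S \<times> (UNIV :: bool set)) S"
    using eqpoll_times_countable[OF assms, of "UNIV :: bool set"] unfolding eqpoll_def by auto
  let ?A = "\<lambda>b. f ` (S \<times> {b})"
  have "?A b \<approx> S" for b
  proof -
    have "inj_on f (S \<times> {b})"
      using f by (auto simp: bij_betw_def inj_on_def)
    then have "?A b \<approx> S \<times> {b}"
      by (rule inj_on_image_eqpoll_self)
    also have "S \<times> {b} \<approx> S"
      by (rule eqpoll_times_countable[OF assms]) auto
    finally show ?thesis .
  qed
  moreover have "?A True \<union> ?A False = S"
    using f UNIV_bool unfolding bij_betw_def by (auto simp flip: image_Un)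
  moreover have "?A True \<inter> ?A False = {}"
    using f by (auto simp: bij_betw_def inj_on_def)
  ultimately show ?thesis
    by (intro that[of "?A True" "?A False"])
qed

lemma permutes_image_eqpoll:
  assumes "p permutes S" and "A \<approx> T"
  shows "p ` A \<approx> T"
  using inj_on_image_eqpoll_self[OF permutes_inj_on[OF assms(1)]] assms(2) by (rule eqpoll_trans)

text \<open>
  A partial bijection of an infinite set need not extend to a permutation; the complements of its
  domain and of its range have to match.
\<close>

lemma extend_to_permutation:
  assumes f: "bij_betw f A B" and "A \<subseteq> S" "B \<subseteq> S" and "S - A \<approx> S - B"
  obtains p where "p permutes S" "\<And>x. x \<in> A \<Longrightarrow> p x = f x"
proof -
  obtain f' where f': "bij_betw f' (S - A) (S - B)"
    using assms(4) unfolding eqpoll_def by (rule exE)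
  define p where "p x = (if x \<in> A then f x else if x \<in> S then f' x else x)" for x
  have "bij_betw p A B"
    using f bij_betw_cong[of A p f B] by (simp add: p_def)
  moreover have "bij_betw p (S - A) (S - B)"
    using f' bij_betw_cong[of "S - A" p f' "S - B"] by (simp add: p_def)
  ultimately have "bij_betw p (A \<union> (S - A)) (B \<union> (S - B))"
    by (rule bij_betw_combine) blast
  moreover have "A \<union> (S - A) = S" "B \<union> (S - B) = S"
    using assms(2,3) by blast+
  ultimately have "bij_betw p S S"
    by (simp only:)
  then have "p permutes S"
    by (rule bij_imp_permutes) (use assms(2) in \<open>auto simp: p_def\<close>)
  then show ?thesis
    by (rule that) (simp add: p_def)
qed

text \<open>
  A permutation that fixes \<open>A\<close> pointwise is supported on \<open>B \<union> C\<close>, so it suffices to undo the action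
  of \<open>g\<close> on \<open>A\<close>. A permutation of \<open>A \<union> B\<close> can do this as soon as the image of \<open>A\<close> lies in \<open>A \<union> B\<close>
  and leaves a large part of \<open>A \<union> B\<close> free. If \<open>B \<union> C\<close> has a large part that avoids the image
  of \<open>A\<close>, a permutation of \<open>B \<union> C\<close> brings the image into this position.
\<close>

lemma factor_permutation:
  assumes "infinite \<Omega>" and \<Omega>: "A \<union> B \<union> C = \<Omega>"
    and disj: "A \<inter> B = {}" "A \<inter> C = {}" "B \<inter> C = {}"
    and large: "A \<approx> \<Omega>" "B \<approx> \<Omega>" "C \<approx> \<Omega>"
    and g: "g permutes \<Omega>" and room: "(B \<union> C) - g ` A \<approx> \<Omega>"
  obtains k h f where "k permutes B \<union> C" "h permutes A \<union> B" "f permutes B \<union> C"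
    "g = k \<circ> h \<circ> f"
proof -
  \<comment> \<open>the free part of \<open>B \<union> C\<close> is halved: \<open>k\<close> maps \<open>Q\<close> onto \<open>C\<close>, which keeps the image of \<open>A\<close> out
    of \<open>C\<close>, and \<open>P\<close> into \<open>B\<close>, where it provides the free space for \<open>h\<close>\<close>
  obtain P Q where PQ: "P \<union> Q = (B \<union> C) - g ` A" "P \<inter> Q = {}" "P \<approx> \<Omega>" "Q \<approx> \<Omega>"
    using split_infinite[of "(B \<union> C) - g ` A"] room assms(1)
    by (metis eqpoll_finite_iff eqpoll_trans)
  obtain q where q: "bij_betw q Q C"
    using eqpoll_trans[OF PQ(4) eqpoll_sym[OF large(3)]] unfolding eqpoll_def by blast
  have "P \<subseteq> (B \<union> C) - Q"
    using PQ by blast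
  then have "(B \<union> C) - Q \<approx> \<Omega>"
    using eqpoll_between[of P _ \<Omega>] PQ \<Omega> by blast
  moreover have "(B \<union> C) - C = B" using disj by blast
  ultimately have "(B \<union> C) - Q \<approx> (B \<union> C) - C"
    using large(2) by (metis eqpoll_sym eqpoll_trans)
  then obtain k where k: "k permutes B \<union> C" and kq: "\<And>x. x \<in> Q \<Longrightarrow> k x = q x"
    using extend_to_permutation[OF q, of "B \<union> C"] PQ(1) by blast
  have kQ: "k ` Q = C"
    using kq q by (simp add: bij_betw_def)
  have k\<Omega>: "k permutes \<Omega>"
    by (rule permutes_subset[OF k]) (use \<Omega> in blast)
  have kg: "k \<circ> g permutes \<Omega>"
    using g k\<Omega> by (rule permutes_compose)
  have disjC: "(k \<circ> g) ` A \<inter> C = {}"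
  proof -
    have "g ` A \<inter> Q = {}" using PQ by blast
    then have "k ` (g ` A) \<inter> k ` Q = {}"
      by (simp add: image_Int[OF permutes_inj[OF k], symmetric])
    then show ?thesis using kQ by (simp add: image_comp)
  qed
  then have sub: "(k \<circ> g) ` A \<subseteq> A \<union> B"
    using permutes_image[OF kg] \<Omega> by blast
  have kP: "k ` P \<approx> \<Omega>"
    using k PQ(3) by (rule permutes_image_eqpoll)
  have "k ` P \<subseteq> (A \<union> B) - (k \<circ> g) ` A"
  proof -
    have "P \<inter> g ` A = {}" "P \<inter> Q = {}" "P \<subseteq> \<Omega>" using PQ \<Omega> by blast+
    then have "k ` P \<inter> k ` (g ` A) = {}" "k ` P \<inter> k ` Q = {}"
      by (simp_all add: image_Int[OF permutes_inj[OF k], symmetric])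
    moreover have "k ` P \<subseteq> \<Omega>"
      using \<open>P \<subseteq> \<Omega>\<close> permutes_image[OF k\<Omega>] by blast
    ultimately show ?thesis using kQ \<Omega> unfolding image_comp by blast
  qed
  then have "(A \<union> B) - (k \<circ> g) ` A \<approx> \<Omega>"
    by (rule eqpoll_between[OF _ _ kP]) (use \<Omega> in blast)
  moreover have "(A \<union> B) - A = B" using disj by blast
  ultimately have eq: "(A \<union> B) - A \<approx> (A \<union> B) - (k \<circ> g) ` A"
    using large(2) by (metis eqpoll_sym eqpoll_trans)
  have "bij_betw (k \<circ> g) A ((k \<circ> g) ` A)"
    using permutes_inj_on[OF kg] by (rule inj_on_imp_bij_betw)
  then obtain h where h: "h permutes A \<union> B" and hA: "\<And>x. x \<in> A \<Longrightarrow> h x = (k \<circ> g) x"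
    using extend_to_permutation[OF _ _ sub eq] by blast
  have h\<Omega>: "h permutes \<Omega>"
    by (rule permutes_subset[OF h]) (use \<Omega> in blast)
  let ?f = "inv_into UNIV h \<circ> (k \<circ> g)"
  have "?f permutes \<Omega>"
    using kg permutes_inv[OF h\<Omega>] by (rule permutes_compose)
  moreover have "?f x = x" if "x \<in> A" for x
    using that hA[OF that, symmetric] permutes_inverses[OF h] by simp
  ultimately have f: "?f permutes B \<union> C"
    by (rule permutes_superset) (use \<Omega> in blast)
  have "g = inv_into UNIV k \<circ> h \<circ> ?f"
    using permutes_inverses[OF h] permutes_inverses[OF k] by (simp add: fun_eq_iff)
  then show ?thesis
    using that permutes_inv[OF k] h f by blast
qed

lemma swap_permutation:
  assumes "A \<approx> C" and "A \<inter> C = {}"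
  obtains s where "s permutes A \<union> C" "s \<circ> s = id" "s ` A = C" "s ` C = A"
proof -
  obtain f where f: "bij_betw f A C"
    using assms(1) unfolding eqpoll_def by blast
  define s where "s x = (if x \<in> A then f x else if x \<in> C then inv_into A f x else x)" for x
  have sA: "s x = f x" "f x \<in> C" if "x \<in> A" for x
    using that f by (auto simp: s_def bij_betw_def)
  have sC: "s x = inv_into A f x" "inv_into A f x \<in> A" if "x \<in> C" for x
    using that f assms(2) bij_betw_inv_into[OF f] by (auto simp: s_def bij_betw_def)
  have ss: "s (s x) = x" for x
  proof -
    consider "x \<in> A" | "x \<in> C" | "x \<notin> A \<union> C" by blast
    then show ?thesis
    proof cases
      case 1 then show ?thesis
        using sA sC f by (simp add: bij_betw_inv_into_left)
    next
      case 2 then show ?thesis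
        using sA sC f by (simp add: bij_betw_inv_into_right)
    next
      case 3 then show ?thesis by (simp add: s_def)
    qed
  qed
  have "s ` A \<subseteq> C" "s ` C \<subseteq> A"
    using sA sC by auto
  then have im: "s ` A = C" "s ` C = A"
    by (auto simp: subset_iff image_iff) (metis ss)+
  have "bij_betw s (A \<union> C) (A \<union> C)"
    by (rule bij_betw_byWitness[where f' = s]) (use ss im in auto)
  then have "s permutes A \<union> C"
    by (rule bij_imp_permutes) (auto simp: s_def)
  then show ?thesis
    using that ss im by (simp add: fun_eq_iff)
qed

section \<open>Boundedness\<close>

text \<open>
  The set \<open>M\<close> is the copy \<open>(0, 0)\<close> under an identification of \<open>\<Omega>\<close> with the grid. Its complement
  is large because it contains the copy \<open>(1, 0)\<close>.
\<close>

lemma (in permutation_filtration) large_support_level: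
  assumes "infinite \<Omega>"
  shows "\<exists>M n. M \<subseteq> \<Omega> \<and> M \<approx> \<Omega> \<and> \<Omega> - M \<approx> \<Omega> \<and> (\<forall>p. p permutes M \<longrightarrow> p \<in> W n)"
proof -
  let ?D = "\<Omega> \<times> (UNIV :: (int \<times> int) set)"
  obtain \<phi> where \<phi>: "bij_betw \<phi> ?D \<Omega>"
    using eqpoll_times_countable[OF assms, of "UNIV :: (int \<times> int) set"]
    unfolding eqpoll_def by auto
  then have inj: "inj_on \<phi> ?D" by (simp add: bij_betw_def)
  interpret D: permutation_filtration ?D
    "\<lambda>n. {p. p permutes ?D \<and> map_permutation ?D \<phi> p \<in> W n}"
    using \<phi> by (rule transport)
  obtain n where n: "\<And>g. g permutes \<Omega> \<Longrightarrow> map_permutation ?D \<phi> (on_copy0 \<Omega> g) \<in> W n"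
    using copy0_level[OF D.permutation_filtration_axioms] by blast
  have \<phi>_eq: "\<phi> (x, c) = \<phi> (y, d) \<longleftrightarrow> x = y \<and> c = d" if "x \<in> \<Omega>" "y \<in> \<Omega>" for x y c d
    using inj_on_eq_iff[OF inj, of "(x, c)" "(y, d)"] that by simp
  let ?\<psi> = "\<lambda>c x. \<phi> (x, c)"
  have inj\<psi>: "inj_on (?\<psi> c) \<Omega>" for c
    by (rule inj_onI) (simp add: \<phi>_eq)
  have copy_large: "?\<psi> c ` \<Omega> \<approx> \<Omega>" for c
    using inj\<psi> by (rule inj_on_image_eqpoll_self)
  have copy_sub: "?\<psi> c ` \<Omega> \<subseteq> \<Omega>" for c
    using \<phi> by (auto simp: bij_betw_def)
  let ?M = "?\<psi> (0, 0) ` \<Omega>"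
  have "?\<psi> (1, 0) ` \<Omega> \<subseteq> \<Omega> - ?M"
    using copy_sub[of "(1, 0)"] by (auto simp: \<phi>_eq)
  then have "\<Omega> - ?M \<approx> \<Omega>"
    by (rule eqpoll_between[OF _ Diff_subset copy_large])
  moreover have "p \<in> W n" if p: "p permutes ?M" for p
  proof -
    have bij: "bij_betw (?\<psi> (0, 0)) \<Omega> ?M"
      using inj\<psi> by (simp add: bij_betw_def)
    define g where "g = map_permutation ?M (inv_into \<Omega> (?\<psi> (0, 0))) p"
    have g: "g permutes \<Omega>"
      unfolding g_def by (rule map_permutation_permutes[OF bij_betw_inv_into[OF bij] p])
    have p_g: "p (?\<psi> (0, 0) x) = ?\<psi> (0, 0) (g x)" if "x \<in> \<Omega>" for x
    proof -
      let ?y = "?\<psi> (0, 0) x"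
      have "?y \<in> ?M" using that by blast
      then have "g (inv_into \<Omega> (?\<psi> (0, 0)) ?y) = inv_into \<Omega> (?\<psi> (0, 0)) (p ?y)"
        unfolding g_def
        by (intro map_permutation_apply bij_betw_imp_inj_on[OF bij_betw_inv_into[OF bij]])
      moreover have "p ?y \<in> ?M"
        using \<open>?y \<in> ?M\<close> permutes_in_image[OF p] by blast
      ultimately show ?thesis
        using inv_into_f_f[OF inj\<psi> that, of "(0, 0)"] f_inv_into_f[of "p ?y" "?\<psi> (0, 0)" \<Omega>]
        by simp
    qed
    have "map_permutation ?D \<phi> (on_copy0 \<Omega> g) y = p y" for y
    proof (cases "y \<in> \<Omega>")
      case True
      then have "y \<in> \<phi> ` ?D"
        using \<phi> by (simp add: bij_betw_def)
      then obtain x i j where y: "y = \<phi> (x, i, j)" "x \<in> \<Omega>"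
        by auto
      then have lhs: "map_permutation ?D \<phi> (on_copy0 \<Omega> g) y = \<phi> (on_copy0 \<Omega> g (x, i, j))"
        using inj by (auto intro: map_permutation_apply)
      show ?thesis
      proof (cases "i = 0 \<and> j = 0")
        case True
        then show ?thesis
          using lhs y p_g by (simp add: on_copy0_apply[OF g])
      next
        case False
        then have "y \<notin> ?M"
          using y by (auto simp: \<phi>_eq)
        then show ?thesis
          using lhs y False permutes_not_in[OF p] by (auto simp: on_copy0_apply[OF g])
      qed
    next
      case False
      then have "y \<notin> \<phi> ` ?D" "y \<notin> ?M"
        using \<phi> copy_sub by (auto simp: bij_betw_def)
      then show ?thesis
        using permutes_not_in[OF p] by (simp add: map_permutation_def)
    qed
    then have "map_permutation ?D \<phi> (on_copy0 \<Omega> g) = p" ..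
    then show ?thesis
      using n[OF g] by simp
  qed
  ultimately show ?thesis
    using copy_sub copy_large by (intro exI[of _ ?M] exI[of _ n] conjI allI impI)
qed

text \<open>
  The complement of \<open>g ` A\<close> is \<open>g ` (B \<union> C)\<close>, hence large, so it is large inside \<open>B \<union> C\<close> or inside
  \<open>A\<close>. In the first case \<open>factor_permutation\<close> applies to \<open>g\<close>; in the second it applies to \<open>s \<circ> g\<close>,
  because \<open>s\<close> moves the free part of \<open>A\<close> into \<open>C\<close>.
\<close>

theorem (in permutation_filtration) bounded:
  assumes inf: "infinite \<Omega>"
  shows "\<exists>n. \<forall>p. p permutes \<Omega> \<longrightarrow> p \<in> W n"
proof -
  obtain M n where M: "M \<subseteq> \<Omega>" "M \<approx> \<Omega>" "\<Omega> - M \<approx> \<Omega>"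
    and n: "\<And>p. p permutes M \<Longrightarrow> p \<in> W n"
    using large_support_level[OF inf] by blast
  obtain A B where AB: "A \<union> B = M" "A \<inter> B = {}" "A \<approx> \<Omega>" "B \<approx> \<Omega>"
    using split_infinite[of M] M(2) inf by (metis eqpoll_finite_iff eqpoll_trans)
  define C where "C = \<Omega> - M"
  have C: "A \<union> B \<union> C = \<Omega>" "A \<inter> C = {}" "B \<inter> C = {}" "C \<approx> \<Omega>"
    using AB M by (auto simp: C_def)
  have "A \<approx> C"
    using AB(3) C(4) by (meson eqpoll_sym eqpoll_trans)
  then obtain s where s: "s permutes A \<union> C" "s \<circ> s = id" "s ` A = C" "s ` C = A"
    using swap_permutation C(2) by blast
  have s\<Omega>: "s permutes \<Omega>"
    by (rule permutes_subset[OF s(1)]) (use C(1) in blast)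
  have ss: "s (s x) = x" for x
    using s(2) by (simp add: fun_eq_iff)
  obtain m where m: "s \<in> W m"
    using exhaustive[OF s\<Omega>] ..
  have BC: "p \<in> W (m + n + m)" if p: "p permutes B \<union> C" for p
  proof -
    have "s \<circ> p \<circ> s permutes \<Omega>"
      by (intro permutes_compose s\<Omega> permutes_subset[OF p]) (use C(1) in blast)
    moreover have "(s \<circ> p \<circ> s) x = x" if "x \<in> C" for x
    proof -
      have "s x \<in> A" using that s(4) by blast
      then have "p (s x) = s x"
        using permutes_not_in[OF p] AB(2) C(2) by blast
      then show ?thesis using ss by simp
    qed
    ultimately have "s \<circ> p \<circ> s permutes M"
      by (rule permutes_superset) (use C_def in blast)
    then have "s \<circ> (s \<circ> p \<circ> s) \<circ> s \<in> W (m + n + m)"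
      using n m comp by blast
    moreover have "s \<circ> (s \<circ> p \<circ> s) \<circ> s = p"
      using ss by (simp add: fun_eq_iff)
    ultimately show ?thesis by simp
  qed
  define N where "N = (m + n + m) + n + (m + n + m)"
  have room: "g \<in> W N" if g: "g permutes \<Omega>" and large: "(B \<union> C) - g ` A \<approx> \<Omega>" for g
  proof -
    obtain k h f where "k permutes B \<union> C" "h permutes A \<union> B" "f permutes B \<union> C" "g = k \<circ> h \<circ> f"
      using factor_permutation[OF inf C(1) AB(2) C(2,3) AB(3,4) C(4) g large] by blast
    then show ?thesis
      unfolding N_def using BC n AB(1) comp by blast
  qed
  have "g \<in> W (m + N)" if g: "g permutes \<Omega>" for g
  proof -
    have BC_sub: "B \<union> C \<subseteq> \<Omega>"
      using C(1) by blast
    have "B \<union> C \<approx> \<Omega>"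
      by (rule eqpoll_between[OF _ _ AB(4)]) (use C(1) in blast)+
    then have "g ` (B \<union> C) \<approx> \<Omega>"
      by (rule permutes_image_eqpoll[OF g])
    moreover have "g ` (B \<union> C) \<subseteq> (A - g ` A) \<union> ((B \<union> C) - g ` A)"
    proof -
      have "A \<inter> (B \<union> C) = {}"
        using AB(2) C(2) by blast
      then have "g ` A \<inter> g ` (B \<union> C) = {}"
        by (simp add: image_Int[OF permutes_inj[OF g], symmetric])
      moreover have "g ` (B \<union> C) \<subseteq> \<Omega>"
        using image_mono[OF BC_sub, of g] by (simp add: permutes_image[OF g])
      moreover have "Y \<subseteq> (A - Z) \<union> ((B \<union> C) - Z)" if "Z \<inter> Y = {}" "Y \<subseteq> \<Omega>" for Y Z
        using that C(1) by blast
      ultimately show ?thesis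
        by simp
    qed
    moreover have "(A - g ` A) \<union> ((B \<union> C) - g ` A) \<subseteq> \<Omega>"
      using C(1) by blast
    ultimately have "(A - g ` A) \<union> ((B \<union> C) - g ` A) \<approx> \<Omega>"
      by (rule eqpoll_between[rotated 2])
    then consider "(B \<union> C) - g ` A \<approx> \<Omega>" | "A - g ` A \<approx> \<Omega>"
      using eqpoll_Un_cases[OF inf] by blast
    then show ?thesis
    proof cases
      case 1
      then show ?thesis
        using room[OF g] mono[of N "m + N"] by auto
    next
      case 2
      have "s ` (A - g ` A) \<approx> \<Omega>"
        using s(1) 2 by (rule permutes_image_eqpoll)
      moreover have "s ` (A - g ` A) \<subseteq> (B \<union> C) - (s \<circ> g) ` A"
      proof -
        have "s ` (A - g ` A) \<inter> s ` (g ` A) = {}"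
          by (simp add: image_Int[OF permutes_inj[OF s(1)], symmetric] Diff_Int_distrib2)
        moreover have "s ` (A - g ` A) \<subseteq> C"
          using image_mono[of "A - g ` A" A s] s(3) by simp
        ultimately show ?thesis
          unfolding image_comp by blast
      qed
      moreover have "(B \<union> C) - (s \<circ> g) ` A \<subseteq> \<Omega>"
        using C(1) by blast
      ultimately have "(B \<union> C) - (s \<circ> g) ` A \<approx> \<Omega>"
        by (rule eqpoll_between[rotated 2])
      then have "s \<circ> g \<in> W N"
        using room permutes_compose[OF g s\<Omega>] by blast
      then have "s \<circ> (s \<circ> g) \<in> W (m + N)"
        using m comp by blast
      moreover have "s \<circ> (s \<circ> g) = g"
        using ss by (simp add: fun_eq_iff)
      ultimately show ?thesis by simp
    qed
  qed
  then show ?thesis by blast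
qed

section \<open>Words\<close>

lemma (in monoid) word_value_closed:
  "set ws \<subseteq> carrier G \<Longrightarrow> word_value G ws \<in> carrier G"
  by (induction ws) (auto simp: word_value_def)

lemma (in monoid) word_value_append:
  "set vs \<subseteq> carrier G \<Longrightarrow> set ws \<subseteq> carrier G \<Longrightarrow>
    word_value G (vs @ ws) = word_value G vs \<otimes> word_value G ws"
proof (induction vs)
  case Nil
  then show ?case using word_value_closed[of ws] by (simp add: word_value_def)
next
  case (Cons v vs)
  then show ?case
    using word_value_closed[of vs] word_value_closed[of ws] by (simp add: word_value_def m_assoc)
qed

lemma monoid_words_mono: "m \<le> n \<Longrightarrow> monoid_words G V m \<subseteq> monoid_words G V n"
  unfolding monoid_words_def by fastforce

lemma (in monoid) monoid_words_mult:
  assumes "V \<subseteq> carrier G" and "x \<in> monoid_words G V m" and "y \<in> monoid_words G V n"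
  shows "x \<otimes> y \<in> monoid_words G V (m + n)"
proof -
  obtain vs ws where "x = word_value G vs" "set vs \<subseteq> V" "length vs \<le> m"
    and "y = word_value G ws" "set ws \<subseteq> V" "length ws \<le> n"
    using assms(2,3) unfolding monoid_words_def by blast
  then show ?thesis
    using assms(1) word_value_append[of vs ws] unfolding monoid_words_def
    by (auto intro!: exI[of _ "vs @ ws"])
qed

lemma (in monoid) generate_monoid_words:
  assumes "V \<subseteq> carrier G" and "x \<in> generate_monoid G V"
  shows "\<exists>n. x \<in> monoid_words G V n"
  using assms(2)
proof induction
  case one
  have "\<one> = word_value G []" by (simp add: word_value_def)
  then show ?case unfolding monoid_words_def by fastforce
next
  case (incl u)
  then have "u = word_value G [u]" using assms(1) by (auto simp: word_value_def)
  then show ?case using incl unfolding monoid_words_def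
    by (intro exI[of _ 1] CollectI exI[of _ "[u]"]) auto
next
  case (eng x y)
  then show ?case using monoid_words_mult[OF assms(1)] by blast
qed

lemma generate_subset_generate_monoid:
  "generate G U \<subseteq> generate_monoid G (U \<union> {inv\<^bsub>G\<^esub> u | u. u \<in> U})"
proof
  fix x assume "x \<in> generate G U"
  then show "x \<in> generate_monoid G (U \<union> {inv\<^bsub>G\<^esub> u | u. u \<in> U})"
    by induction (auto intro: generate_monoid.intros)
qed

lemma group_words_eq_monoid_words:
  "group_words G U n = monoid_words G (U \<union> {inv\<^bsub>G\<^esub> u | u. u \<in> U}) n"
  by (simp add: group_words_def monoid_words_def)

lemma restrict_permutation_in_BijGroup:
  "p permutes \<Omega> \<Longrightarrow> restrict p \<Omega> \<in> carrier (BijGroup \<Omega>)"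
  by (simp add: BijGroup_def Bij_def bij_betw_restrict_eq permutes_imp_bij)

text \<open>
  Elements of \<open>BijGroup \<Omega>\<close> are undefined outside \<open>\<Omega>\<close>; restriction to \<open>\<Omega>\<close> matches them with the
  permutations that fix all points outside \<open>\<Omega>\<close>, and so carries the word filtration over.
\<close>

lemma BijGroup_bounded:
  assumes inf: "infinite \<Omega>" and V: "V \<subseteq> carrier (BijGroup \<Omega>)"
    and gen: "carrier (BijGroup \<Omega>) \<subseteq> generate_monoid (BijGroup \<Omega>) V"
  shows "\<exists>n>0. \<forall>g \<in> carrier (BijGroup \<Omega>). g \<in> monoid_words (BijGroup \<Omega>) V n"
proof -
  interpret B: group "BijGroup \<Omega>" by (rule group_BijGroup)
  let ?W = "\<lambda>n. {p. p permutes \<Omega> \<and> restrict p \<Omega> \<in> monoid_words (BijGroup \<Omega>) V n}"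
  interpret permutation_filtration \<Omega> ?W
  proof
    fix f g m n assume fg: "f \<in> ?W m" "g \<in> ?W n"
    then have "restrict (f \<circ> g) \<Omega> = restrict f \<Omega> \<otimes>\<^bsub>BijGroup \<Omega>\<^esub> restrict g \<Omega>"
      using restrict_permutation_in_BijGroup[of f \<Omega>] restrict_permutation_in_BijGroup[of g \<Omega>]
      by (auto simp: BijGroup_def compose_def permutes_in_image fun_eq_iff)
    then show "f \<circ> g \<in> ?W (m + n)"
      using fg B.monoid_words_mult[OF V] by (auto intro: permutes_compose)
  next
    fix p assume "p permutes \<Omega>"
    then show "\<exists>n. p \<in> ?W n"
      using restrict_permutation_in_BijGroup gen B.generate_monoid_words[OF V] by blast
  next
    fix m n :: nat assume "m \<le> n"
    then show "?W m \<subseteq> ?W n"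
      using monoid_words_mono[of m n "BijGroup \<Omega>" V] by (auto simp: subset_iff)
  qed
  obtain n where n: "\<forall>p. p permutes \<Omega> \<longrightarrow> p \<in> ?W n"
    using bounded[OF inf] by (rule exE)
  have "g \<in> monoid_words (BijGroup \<Omega>) V (Suc n)" if "g \<in> carrier (BijGroup \<Omega>)" for g
  proof -
    have g: "g \<in> extensional \<Omega>" "bij_betw g \<Omega> \<Omega>"
      using that by (auto simp: BijGroup_def Bij_def)
    define p where "p x = (if x \<in> \<Omega> then g x else x)" for x
    have "bij_betw p \<Omega> \<Omega>"
      using g(2) bij_betw_cong[of \<Omega> p g \<Omega>] by (simp add: p_def)
    then have "p permutes \<Omega>"
      by (rule bij_imp_permutes) (simp add: p_def)
    then have "restrict p \<Omega> \<in> monoid_words (BijGroup \<Omega>) V n"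
      using n by simp
    moreover have "restrict p \<Omega> = g"
      using g(1) by (intro ext) (simp add: p_def restrict_def extensional_def)
    ultimately show ?thesis
      using monoid_words_mono[of n "Suc n" "BijGroup \<Omega>" V] by (simp add: subset_iff)
  qed
  then show ?thesis
    by (intro exI[of _ "Suc n"]) simp
qed

theorem theorem6:
  fixes \<Omega> :: "'a set" and U :: "('a \<Rightarrow> 'a) set"
  assumes "infinite \<Omega>" and "U \<subseteq> carrier (BijGroup \<Omega>)"
  shows "(generate (BijGroup \<Omega>) U = carrier (BijGroup \<Omega>) \<longrightarrow>
            (\<exists>n>0. \<forall>g \<in> carrier (BijGroup \<Omega>). g \<in> group_words (BijGroup \<Omega>) U n)) \<and>
         (generate_monoid (BijGroup \<Omega>) U = carrier (BijGroup \<Omega>) \<longrightarrow>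
            (\<exists>n>0. \<forall>g \<in> carrier (BijGroup \<Omega>). g \<in> monoid_words (BijGroup \<Omega>) U n))"
proof (intro conjI impI)
  let ?V = "U \<union> {inv\<^bsub>BijGroup \<Omega>\<^esub> u | u. u \<in> U}"
  assume "generate (BijGroup \<Omega>) U = carrier (BijGroup \<Omega>)"
  then have "carrier (BijGroup \<Omega>) \<subseteq> generate_monoid (BijGroup \<Omega>) ?V"
    using generate_subset_generate_monoid[of "BijGroup \<Omega>" U] by simp
  moreover have "?V \<subseteq> carrier (BijGroup \<Omega>)"
    using assms(2) group.inv_closed[OF group_BijGroup] by blast
  ultimately show "\<exists>n>0. \<forall>g \<in> carrier (BijGroup \<Omega>). g \<in> group_words (BijGroup \<Omega>) U n"
    unfolding group_words_eq_monoid_words by (intro BijGroup_bounded assms(1))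
next
  assume "generate_monoid (BijGroup \<Omega>) U = carrier (BijGroup \<Omega>)"
  then show "\<exists>n>0. \<forall>g \<in> carrier (BijGroup \<Omega>). g \<in> monoid_words (BijGroup \<Omega>) U n"
    using BijGroup_bounded[OF assms] by simp
qed

end
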